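(* Let $q=p^h$ with $p$ prime and $q>p$, and let $m\ge 1$. If $\mathbf{s}\in\mathcal{C}_{\mathrm{PG}}(m,q)^\perp$ is nonzero, then \[w(\mathbf{s})\geq 2\left(q^{m-1}\frac{p-1}{p}+q^{m-2}\right).\]
   Context: The code $\mathcal{C}_{\mathrm{PG}}(m,q)\subseteq\mathbb{F}_p^{v}$, $v=(q^{m+1}-1)/(q-1)$, is the $\mathbb{F}_p$-span of the incidence vectors (indexed by the points) of the lines of $\mathrm{PG}(m,q)$; $\mathcal{C}_{\mathrm{PG}}(m,q)^\perp$ is the set of vectors orthogonal to all codewords under the standard inner product. The weight $w(\mathbf{s})$ is the number of nonzero coordinates of $\mathbf{s}$. *)

theory Defs
  imports "HOL-Analysis.Cartesian_Space" "HOL-Computational_Algebra.Primes"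
begin

text \<open>The projective space PG(m,q) is modelled on \<open>'k ^ 'n\<close>, where \<open>'k\<close> is the field with q
  elements and \<open>CARD('n) = m + 1\<close>.\<close>

typedef (overloaded) ('k, 'n) pg_point =
  "{U :: (('k :: {field,finite}) ^ ('n :: finite)) set. vec.subspace U \<and> vec.dim U = 1}"
  morphisms subspace_of_point point_of_subspace
proof -
  have "vec.dim (vec.span {axis undefined 1 :: 'k ^ 'n}) = card {axis undefined 1 :: 'k ^ 'n}"
    by (intro vec.dim_span_eq_card_independent) (simp add: axis_eq_0_iff)
  then have "vec.span {axis undefined 1 :: 'k ^ 'n} \<in> {U. vec.subspace U \<and> vec.dim U = 1}"
    by simp
  then show ?thesis by blast
qed

text \<open>Finiteness allows the points to index the coordinates of a vector.\<close>

instance pg_point :: ("{field,finite}", finite) finite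
proof
  have "finite (range (subspace_of_point :: ('a, 'b) pg_point \<Rightarrow> _))"
    by simp
  then show "finite (UNIV :: ('a, 'b) pg_point set)"
    by (rule finite_imageD) (simp add: inj_def subspace_of_point_inject)
qed

definition pg_lines :: "('k :: {field,finite}, 'n :: finite) pg_point set set" where
  "pg_lines = {{P. subspace_of_point P \<subseteq> W} | W. vec.subspace W \<and> vec.dim W = 2}"

definition incidence_vector :: "'a :: finite set \<Rightarrow> 'f :: field ^ 'a" where
  "incidence_vector l = (\<chi> P. if P \<in> l then 1 else 0)"

definition code_PG :: "('f :: field ^ ('k :: {field,finite}, 'n :: finite) pg_point) set" where
  "code_PG = vec.span (incidence_vector ` pg_lines)"

definition dual_code :: "('f :: field ^ 'a :: finite) set \<Rightarrow> ('f ^ 'a) set" where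
  "dual_code C = {s. \<forall>c\<in>C. (\<Sum>P\<in>UNIV. s $ P * c $ P) = 0}"

definition weight :: "'f :: field ^ 'a :: finite \<Rightarrow> nat" where
  "weight s = card {P. s $ P \<noteq> 0}"

end

theory Submission
  imports Defs "HOL-Analysis.Convex" "HOL-Number_Theory.Residues"
begin

text \<open>
  A codeword of the dual becomes a function \<open>F\<close> on vectors that is constant on punctured
  one-dimensional subspaces and sums to zero over every two-dimensional one; the bound is proved
  for every subspace \<open>U\<close> on which \<open>F\<close> does not vanish, by induction on its dimension.

  In a plane, let \<open>b\<close> be a value of \<open>F\<close>. If \<open>-b\<close> is not a value, every line through a point of value
  \<open>b\<close> meets the support in at least three points. Otherwise lift \<open>F/b\<close> and \<open>-F/b\<close> to
  \<open>{0..<p}\<close>: on the lines through a point of value \<open>b\<close> (respectively \<open>-b\<close>) the lifts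
  at the other points add up to at least \<open>p - 1\<close>, while the two lifts add up to \<open>p\<close> on the support.

  In higher dimension, suppose the support \<open>S\<close> is too small. Averaging shows that a subspace missing
  \<open>S\<close> extends to one of the next dimension missing \<open>S\<close>, so some hyperplane \<open>H\<close> misses \<open>S\<close>, and we
  work in the affine space off \<open>H\<close>. If all \<open>q\<close> members of a parallel class of hyperplanes met \<open>S\<close>,
  induction would give the bound, so every class has a member missing \<open>S\<close>. A second moment
  count over all classes then yields \<open>|S| \<le> (q - 1)\<^sup>2\<close>, contradicting that every line through a
  point of \<open>S\<close> contains another one.
\<close>

section \<open>Sums and cardinalities in subspaces\<close>

text \<open>Outside \<open>T\<close> every vector of the span is \<open>a *s (v + t)\<close> for
  exactly one nonzero \<open>a\<close> and one \<open>t\<close> in \<open>T\<close>, and invariance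
  of \<open>g\<close> under scaling turns the sum over \<open>a\<close> into a factor. Projectively
  this splits a space into a hyperplane and the affine part off it.\<close>

lemma sum_span_insert:
  fixes g :: "('k :: {field,finite}) ^ ('n :: finite) \<Rightarrow> 'b :: comm_semiring_1"
  assumes T: "vec.subspace T" and v: "v \<notin> T"
    and g: "\<And>a x. a \<noteq> 0 \<Longrightarrow> g (a *s x) = g x"
  shows "sum g (vec.span (insert v T)) =
    sum g T + of_nat (CARD('k) - 1) * (\<Sum>t\<in>T. g (v + t))"
proof -
  let ?V = "vec.span (insert v T)" and ?N = "UNIV - {0 :: 'k}"
  let ?f = "\<lambda>(a, t). a *s (v + t)"
  have span_T: "vec.span T = T"
    using T by (simp add: vec.span_eq_iff)
  have sub: "T \<subseteq> ?V"
    using vec.span_superset by blast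
  have inj: "inj_on ?f (?N \<times> T)"
  proof (rule inj_onI)
    fix z z' assume z: "z \<in> ?N \<times> T" "z' \<in> ?N \<times> T" "?f z = ?f z'"
    obtain a t b u where zz: "z = (a, t)" "z' = (b, u)"
      by (metis surj_pair)
    then have a: "a \<noteq> 0" and t: "t \<in> T" and u: "u \<in> T"
      and eq: "a *s (v + t) = b *s (v + u)"
      using z by auto
    have "(a - b) *s v = b *s u - a *s t"
      using eq by (simp add: vector_add_ldistrib vector_sub_rdistrib algebra_simps)
    also have "\<dots> \<in> T"
      using T t u by (intro vec.subspace_diff vec.subspace_scale)
    finally have "(1 / (a - b)) *s ((a - b) *s v) \<in> T"
      using vec.subspace_scale[OF T] by blast
    moreover have "(1 / (a - b)) *s ((a - b) *s v) = v" if "a \<noteq> b"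
      using that by (simp add: vector_smult_assoc)
    ultimately have "a = b"
      using v by metis
    then show "z = z'"
      using eq a zz by simp
  qed
  have img: "?f ` (?N \<times> T) = ?V - T"
  proof (intro equalityI subsetI)
    fix x assume "x \<in> ?f ` (?N \<times> T)"
    then obtain a t where a: "a \<noteq> 0" and t: "t \<in> T" and x: "x = a *s (v + t)"
      by auto
    have "x \<in> ?V"
      unfolding x using t by (intro vec.span_scale vec.span_add vec.span_base) auto
    moreover have "x \<notin> T"
    proof
      assume "x \<in> T"
      then have "(1 / a) *s x - t \<in> T"
        using T t by (intro vec.subspace_diff vec.subspace_scale)
      then show False
        using v a by (simp add: x vector_smult_assoc)
    qed
    ultimately show "x \<in> ?V - T" by simp
  next
    fix x assume x: "x \<in> ?V - T"
    then obtain a where a: "x - a *s v \<in> T"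
      by (auto simp: vec.span_insert span_T)
    then have "a \<noteq> 0"
      using x by auto
    moreover have "x = a *s (v + (1 / a) *s (x - a *s v))"
      using \<open>a \<noteq> 0\<close> by (simp add: vector_add_ldistrib vector_smult_assoc)
    moreover have "(1 / a) *s (x - a *s v) \<in> T"
      using T a by (intro vec.subspace_scale)
    ultimately show "x \<in> ?f ` (?N \<times> T)"
      by (intro image_eqI[where x = "(a, (1 / a) *s (x - a *s v))"]) auto
  qed
  have "sum g (?V - T) = (\<Sum>z\<in>?N \<times> T. g (?f z))"
    unfolding img[symmetric] by (simp add: sum.reindex[OF inj])
  also have "\<dots> = (\<Sum>a\<in>?N. \<Sum>t\<in>T. g (v + t))"
    unfolding sum.cartesian_product
    by (intro sum.cong refl) (simp add: g case_prod_beta mem_Times_iff)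
  also have "\<dots> = of_nat (CARD('k) - 1) * (\<Sum>t\<in>T. g (v + t))"
    by (simp add: card_Diff_singleton)
  finally show ?thesis
    using sum.subset_diff[OF sub, of g] by (simp add: add.commute)
qed

lemma card_span_insert:
  fixes T :: "(('k :: {field,finite}) ^ ('n :: finite)) set"
  assumes "vec.subspace T" and "v \<notin> T"
  shows "card (vec.span (insert v T)) = CARD('k) * card T"
proof -
  have "0 < CARD('k)" by simp
  then show ?thesis
    using sum_span_insert[OF assms, of "\<lambda>_. 1 :: nat"] by (cases "CARD('k)") auto
qed

text \<open>Translation by an element of \<open>T\<close> permutes \<open>U - T\<close>, so each
  vector there is counted \<open>card T\<close> times. This converts bounds on single cosets of
  \<open>T\<close> into a bound on \<open>U\<close>.\<close>

lemma sum_translates: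
  fixes g :: "('k :: {field,finite}) ^ ('n :: finite) \<Rightarrow> 'b :: comm_semiring_1"
  assumes T: "vec.subspace T" and U: "vec.subspace U" and sub: "T \<subseteq> U"
  shows "(\<Sum>v\<in>U - T. \<Sum>t\<in>T. g (v + t)) = of_nat (card T) * sum g (U - T)"
proof -
  have "(\<Sum>v\<in>U - T. g (v + t)) = sum g (U - T)" if t: "t \<in> T" for t
  proof (rule sum.reindex_bij_witness[of _ "\<lambda>v. v - t" "\<lambda>v. v + t"])
    fix v assume v: "v \<in> U - T"
    show "v + t \<in> U - T"
      using v t sub vec.subspace_add[OF U, of v t] vec.subspace_diff[OF T, of "v + t" t] by auto
    show "v - t \<in> U - T"
      using v t sub vec.subspace_diff[OF U, of v t] vec.subspace_add[OF T, of "v - t" t] by auto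
  qed auto
  then have "(\<Sum>t\<in>T. \<Sum>v\<in>U - T. g (v + t)) = of_nat (card T) * sum g (U - T)"
    by simp
  then show ?thesis
    by (subst sum.swap)
qed

text \<open>Subtracting \<open>(f x / f z) *s z\<close> moves any \<open>x\<close> in
  \<open>H\<close> into the kernel, so the kernel and \<open>z\<close> together span
  \<open>H\<close>.\<close>

lemma card_kernel:
  fixes f :: "('k :: {field,finite}) ^ ('n :: finite) \<Rightarrow> 'k"
  assumes H: "vec.subspace H" and z: "z \<in> H" "f z \<noteq> 0"
    and add: "\<And>x y. f (x + y) = f x + f y" and scale: "\<And>a x. f (a *s x) = a * f x"
  shows "vec.subspace {x \<in> H. f x = 0}" and "card H = CARD('k) * card {x \<in> H. f x = 0}"
proof -
  let ?K = "{x \<in> H. f x = 0}"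
  have "f 0 = 0"
    using scale[of 0 0] by simp
  then show K: "vec.subspace ?K"
    using H add scale by (auto simp: vec.subspace_def)
  have "vec.span (insert z ?K) = H"
  proof (intro equalityI subsetI)
    fix x assume "x \<in> vec.span (insert z ?K)"
    then show "x \<in> H"
      using vec.span_minimal[of "insert z ?K" H] H z by blast
  next
    fix x assume x: "x \<in> H"
    let ?y = "x - (f x / f z) *s z"
    have "f x = f ?y + f ((f x / f z) *s z)"
      by (simp flip: add)
    then have "?y \<in> ?K"
      using x z H by (auto simp: scale intro!: vec.subspace_diff vec.subspace_scale)
    then have "?y + (f x / f z) *s z \<in> vec.span (insert z ?K)"
      by (intro vec.span_add vec.span_scale vec.span_base) auto
    then show "x \<in> vec.span (insert z ?K)"
      by simp
  qed
  then show "card H = CARD('k) * card ?K"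
    using card_span_insert[OF K, of z] z by simp
qed

section \<open>Natural number representatives of a prime field\<close>

text \<open>\<open>L\<close> picks the representative below the order of the field. An equation in
  the field thereby becomes a lower bound for a sum of natural numbers, which is how the plane case
  uses the last property.\<close>

lemma prime_field_lift:
  assumes "prime CARD('f :: field)"
  obtains L :: "'f :: field \<Rightarrow> nat" where
    "\<And>x. of_nat (L x) = x" "L 0 = 0" "L 1 = 1"
    "\<And>x. x \<noteq> 0 \<Longrightarrow> L x + L (- x) = CARD('f)"
    "\<And>m. of_nat m = (-1 :: 'f :: field) \<Longrightarrow> CARD('f) \<le> m + 1"
proof -
  let ?p = "CARD('f)"
  have fin: "finite (UNIV :: 'f set)"
    using assms prime_gt_0_nat by (intro card_ge_0_finite) auto
  \<comment> \<open>The characteristic divides a prime and is not 1, so it equals the order of the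
    field and the residues exhaust the field.\<close>
  have "CHAR('f) dvd ?p"
    using fin CHAR_dvd_CARD by blast
  then have char: "CHAR('f) = ?p"
    using assms CHAR_not_1[where 'a = 'f] by (auto simp: prime_nat_iff)
  have zero: "of_nat n = (0 :: 'f) \<longleftrightarrow> ?p dvd n" for n
    using char by (simp add: of_nat_eq_0_iff_char_dvd)
  have inj: "inj_on (of_nat :: nat \<Rightarrow> 'f) {..<?p}"
    by (rule inj_onI) (simp add: of_nat_eq_iff_cong_CHAR char cong_def)
  then have "of_nat ` {..<?p} = (UNIV :: 'f set)"
    using fin by (intro card_subset_eq) (auto simp: card_image)
  then have "\<forall>x :: 'f. \<exists>n. n < ?p \<and> of_nat n = x"
    by (metis UNIV_I imageE lessThan_iff)
  then obtain L :: "'f \<Rightarrow> nat" where L: "\<And>x. L x < ?p" "\<And>x. of_nat (L x) = x"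
    by metis
  have p: "1 < ?p"
    using assms prime_gt_1_nat by blast
  have uniq: "L x = n" if "n < ?p" "of_nat n = x" for x n
    using that L[of x] inj by (auto simp: inj_on_def)
  show thesis
  proof (rule that[OF L(2)])
    show "L 0 = 0" "L 1 = 1"
      using p by (auto intro!: uniq)
    fix x :: 'f assume x: "x \<noteq> 0"
    then have "L x \<noteq> 0"
      using L(2)[of x] by (metis of_nat_0)
    have "of_nat (?p - L x) = - x"
      using L(1)[of x] L(2)[of x] zero[of ?p] by (simp add: of_nat_diff)
    then have "L (- x) = ?p - L x"
      using \<open>L x \<noteq> 0\<close> L(1)[of x] by (intro uniq) auto
    then show "L x + L (- x) = ?p"
      using L(1)[of x] by simp
  next
    fix m assume "of_nat m = (-1 :: 'f)"
    then have "of_nat (m + 1) = (0 :: 'f)" by simp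
    then show "?p \<le> m + 1"
      unfolding zero by (rule dvd_imp_le) simp
  qed
qed


section \<open>Second moment count over linear forms\<close>

text \<open>Each form takes at most \<open>q - 1\<close> values on \<open>S\<close>, so by
  Cauchy-Schwarz it agrees on at least \<open>w^2 / (q - 1)\<close> of the \<open>w^2\<close>
  ordered pairs from \<open>S\<close>. On the other hand, two distinct vectors are identified by
  only a fraction \<open>1 / q\<close> of all forms.\<close>

lemma card_le_if_functionals_not_onto:
  fixes S :: "(('k :: {field,finite}) ^ ('n :: finite)) set"
  assumes miss: "\<And>y. \<exists>c. \<forall>x\<in>S. (\<Sum>i\<in>UNIV. y $ i * x $ i) \<noteq> c"
  shows "card S \<le> (CARD('k) - 1)\<^sup>2"
proof -
  define dot :: "'k ^ 'n \<Rightarrow> 'k ^ 'n \<Rightarrow> 'k" where "dot y x = (\<Sum>i\<in>UNIV. y $ i * x $ i)" for y x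
  let ?q = "CARD('k)" and ?Q = "CARD('k ^ 'n)"
  define w where "w = card S"
  define m where "m y c = card {x \<in> S. dot y x = c}" for y c
  have fib: "m y c = (\<Sum>x\<in>S. of_bool (dot y x = c))" for y c
    by (simp add: m_def sum_of_bool_eq Int_def)
  have sum_m: "(\<Sum>c\<in>UNIV. m y c) = w" for y
    unfolding fib w_def by (subst sum.swap) simp
  have sum_m2: "(\<Sum>c\<in>UNIV. (m y c)\<^sup>2) = (\<Sum>x\<in>S. \<Sum>x'\<in>S. of_bool (dot y (x - x') = 0))" for y
  proof -
    have "(m y c)\<^sup>2 = (\<Sum>x\<in>S. \<Sum>x'\<in>S. of_bool (dot y x = c) * of_bool (dot y x' = c))" for c
      unfolding fib power2_eq_square sum_product ..
    then have "(\<Sum>c\<in>UNIV. (m y c)\<^sup>2) =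
        (\<Sum>c\<in>UNIV. \<Sum>x\<in>S. \<Sum>x'\<in>S. of_bool (dot y x = c) * of_bool (dot y x' = c))"
      by simp
    also have "\<dots> = (\<Sum>x\<in>S. \<Sum>x'\<in>S. \<Sum>c\<in>UNIV. of_bool (dot y x = c) * of_bool (dot y x' = c))"
      by (rule trans[OF sum.swap], rule sum.cong[OF refl], rule sum.swap)
    also have "\<dots> = (\<Sum>x\<in>S. \<Sum>x'\<in>S. of_bool (dot y (x - x') = 0))"
    proof (intro sum.cong refl)
      fix x x'
      have "dot y (x - x') = dot y x - dot y x'"
        by (simp add: dot_def sum_subtractf algebra_simps)
      then have "of_bool (dot y x = c) * of_bool (dot y x' = c) =
          (if dot y x = c then of_bool (dot y (x - x') = 0) else 0 :: nat)" for c
        by auto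
      then show "(\<Sum>c\<in>UNIV. of_bool (dot y x = c) * of_bool (dot y x' = c)) =
          (of_bool (dot y (x - x') = 0) :: nat)"
        by (simp only:) simp
    qed
    finally show ?thesis .
  qed
  \<comment> \<open>The fibre over the missed value \<open>c0\<close> is empty, so Cauchy-Schwarz
    runs over \<open>q - 1\<close> fibres only.\<close>
  have cs: "w\<^sup>2 \<le> (?q - 1) * (\<Sum>c\<in>UNIV. (m y c)\<^sup>2)" for y
  proof -
    obtain c0 where c0: "\<forall>x\<in>S. dot y x \<noteq> c0"
      using miss unfolding dot_def by blast
    then have m0: "m y c0 = 0"
      by (simp add: m_def)
    let ?A = "UNIV - {c0}"
    have "(\<Sum>c\<in>?A. real (m y c))\<^sup>2 \<le> (\<Sum>c\<in>?A. (real (m y c))\<^sup>2) * real (card ?A)"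
      by (rule sum_squared_le_sum_of_squares)
    then have "real ((\<Sum>c\<in>?A. m y c)\<^sup>2) \<le> real ((\<Sum>c\<in>?A. (m y c)\<^sup>2) * card ?A)"
      by simp
    then have "(\<Sum>c\<in>?A. m y c)\<^sup>2 \<le> (\<Sum>c\<in>?A. (m y c)\<^sup>2) * card ?A"
      by (simp only: of_nat_le_iff)
    moreover have "(\<Sum>c\<in>?A. m y c) = w"
      using sum_m[of y] m0 by (simp add: sum.remove[of UNIV c0])
    moreover have "(\<Sum>c\<in>?A. (m y c)\<^sup>2) = (\<Sum>c\<in>UNIV. (m y c)\<^sup>2)"
      using m0 by (simp add: sum.remove[of UNIV c0])
    ultimately show ?thesis
      by (simp add: card_Diff_singleton mult.commute)
  qed
  \<comment> \<open>For distinct \<open>x\<close> and \<open>x'\<close> the condition on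
    \<open>y\<close> cuts out the kernel of a nonzero linear form. The factor \<open>?q\<close> on
    the left avoids a division.\<close>
  have ker: "?q * (\<Sum>y\<in>UNIV. of_bool (dot y (x - x') = 0)) = (if x = x' then ?q * ?Q else ?Q)" for x x'
  proof (cases "x = x'")
    case True
    then show ?thesis by (simp add: dot_def)
  next
    case False
    then obtain i where i: "(x - x') $ i \<noteq> 0"
      by (auto simp: vec_eq_iff)
    have "dot (axis i 1) (x - x') = (x - x') $ i"
      by (simp add: dot_def axis_def if_distrib[where f = "\<lambda>a. a * _"] cong: if_cong)
    then have "?Q = ?q * card {y \<in> UNIV. dot y (x - x') = 0}"
      using i by (intro card_kernel(2)[of UNIV "axis i 1"])
        (auto simp: dot_def sum.distrib distrib_right sum_distrib_left mult.assoc)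
    then show ?thesis
      using False by (simp add: sum_of_bool_eq)
  qed
  have "(\<Sum>y\<in>(UNIV :: ('k ^ 'n) set). w\<^sup>2) \<le> (\<Sum>y\<in>UNIV. (?q - 1) * (\<Sum>c\<in>UNIV. (m y c)\<^sup>2))"
    by (intro sum_mono cs)
  then have "?Q * w\<^sup>2 * ?q \<le> ?q * (\<Sum>y\<in>UNIV. (?q - 1) * (\<Sum>c\<in>UNIV. (m y c)\<^sup>2))"
    by simp
  also have "\<dots> = (?q - 1) * (\<Sum>x\<in>S. \<Sum>x'\<in>S. ?q * (\<Sum>y\<in>UNIV. of_bool (dot y (x - x') = 0)))"
  proof -
    have "(\<Sum>y\<in>UNIV. \<Sum>c\<in>UNIV. (m y c)\<^sup>2) =
        (\<Sum>x\<in>S. \<Sum>x'\<in>S. \<Sum>y\<in>UNIV. of_bool (dot y (x - x') = 0))"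
      unfolding sum_m2 by (rule trans[OF sum.swap], rule sum.cong[OF refl], rule sum.swap)
    then show ?thesis
      by (simp flip: sum_distrib_left)
  qed
  also have "\<dots> = (?q - 1) * (\<Sum>x\<in>S. (?q * ?Q + (w - 1) * ?Q))"
  proof -
    have "(\<Sum>x'\<in>S. if x = x' then ?q * ?Q else ?Q) = ?q * ?Q + (w - 1) * ?Q" if "x \<in> S" for x
    proof -
      have "(\<Sum>x'\<in>S - {x}. if x = x' then ?q * ?Q else ?Q) = (\<Sum>x'\<in>S - {x}. ?Q)"
        by (intro sum.cong) auto
      then show ?thesis
        using that by (simp add: sum.remove[of S x] w_def card_Diff_singleton)
    qed
    then show ?thesis
      unfolding ker by simp
  qed
  finally have "(?Q * w) * (w * ?q) \<le> (?Q * w) * ((?q - 1) * (?q + (w - 1)))"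
    by (simp add: w_def power2_eq_square algebra_simps)
  \<comment> \<open>The common factor vanishes only for empty \<open>S\<close>, where the claim is
    trivial.\<close>
  then have "0 < ?Q * w \<longrightarrow> w * ?q \<le> (?q - 1) * (?q + (w - 1))"
    by (simp only: mult_le_cancel1)
  moreover have "w = 0 \<or> 0 < ?Q * w" by auto
  ultimately have "w = 0 \<or> w * ?q \<le> (?q - 1) * (?q + (w - 1))"
    by metis
  moreover have "0 < ?q" by simp
  ultimately show ?thesis
    unfolding w_def[symmetric]
    by (cases ?q; cases w) (auto simp: power2_eq_square algebra_simps)
qed

section \<open>Functions on vectors that sum to zero over lines\<close>

text \<open>The summand \<open>F R\<close> in the last axiom is the contribution of the point at infinity of the
  affine line \<open>v + \<langle>R\<rangle>\<close>.\<close>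

locale line_null =
  fixes F :: "('k :: {field,finite}) ^ ('n :: finite) \<Rightarrow> 'f :: field" and p q :: nat
  assumes card_f [simp]: "CARD('f :: field) = p" and card_k [simp]: "CARD('k) = q"
    and prime_p: "prime p" and card_le: "p \<le> q"
    and zero: "F 0 = 0"
    and scale: "\<And>a x. a \<noteq> 0 \<Longrightarrow> F (a *s x) = F x"
    and line: "\<And>R v. R \<noteq> 0 \<Longrightarrow> v \<notin> vec.span {R} \<Longrightarrow> F R + (\<Sum>t\<in>vec.span {R}. F (v + t)) = 0"
begin

text \<open>In projective terms \<open>B / p\<close> is the lower bound for the weight in a plane.\<close>

abbreviation B :: nat where "B \<equiv> 2 * ((p - 1) * q + p)"

text \<open>Vectors are counted instead of points, so on a subspace \<open>W\<close> is
  \<open>q - 1\<close> times the number of support points. The form as a sum of indicators suits the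
  identities for sums over subspaces.\<close>

definition W :: "('k ^ 'n) set \<Rightarrow> nat" where
  "W U = (\<Sum>v\<in>U. of_bool (F v \<noteq> 0))"

lemma p_gt_1: "1 < p"
  using prime_p prime_gt_1_nat by blast

lemma q_pos: "0 < q"
  using p_gt_1 card_le by simp

section \<open>Counting along the lines through a point\<close>

text \<open>\<open>U\<close> contains \<open>q ^ k - 1\<close> cosets of the span of
  \<open>R\<close> besides the span itself, and each carries at least \<open>c\<close>. Up to
  scaling, such a coset is a line through the point \<open>R\<close> with that point
  removed.\<close>

lemma sum_ge_lines_through:
  fixes G :: "'k ^ 'n \<Rightarrow> nat"
  assumes U: "vec.subspace U" "card U = q ^ Suc k" and R: "R \<in> U" "R \<noteq> 0"
    and G: "G 0 = 0" "\<And>a x. a \<noteq> 0 \<Longrightarrow> G (a *s x) = G x"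
    and ge: "\<And>v. v \<in> U \<Longrightarrow> v \<notin> vec.span {R} \<Longrightarrow> c \<le> (\<Sum>t\<in>vec.span {R}. G (v + t))"
  shows "(q - 1) * G R + c * (q ^ k - 1) \<le> sum G U"
proof -
  let ?T = "vec.span {R}"
  have span: "vec.span (insert R {0}) = ?T"
    by (simp add: insert_commute)
  have sub: "?T \<subseteq> U"
    using U R by (intro vec.span_minimal) auto
  have zero: "vec.subspace ({0} :: ('k ^ 'n) set)"
    by (simp add: vec.subspace_def)
  have card_T: "card ?T = q"
    using card_span_insert[OF zero, of R] R span by simp
  have sum_T: "sum G ?T = (q - 1) * G R"
    using sum_span_insert[OF zero, of R G] R G span by simp
  have "c * card (U - ?T) \<le> (\<Sum>v\<in>U - ?T. \<Sum>t\<in>?T. G (v + t))"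
    using sum_mono[of "U - ?T" "\<lambda>_. c"] ge by (simp add: mult.commute)
  also have "\<dots> = q * sum G (U - ?T)"
    using U sub card_T by (simp add: sum_translates)
  finally have "q * (c * (q ^ k - 1)) \<le> q * sum G (U - ?T)"
    using U sub card_T by (simp add: card_Diff_subset algebra_simps)
  then have "c * (q ^ k - 1) \<le> sum G (U - ?T)"
    using q_pos by simp
  then show ?thesis
    using sum.subset_diff[OF sub, of G] sum_T by simp
qed

text \<open>A single nonzero value cannot sum to zero, so every line through the support point
  \<open>R\<close> contains a second one.\<close>

lemma W_ge:
  assumes U: "vec.subspace U" "card U = q ^ Suc k" and R: "R \<in> U" "F R \<noteq> 0"
  shows "(q - 1) + (q ^ k - 1) \<le> W U"
proof -
  have R0: "R \<noteq> 0"
    using R zero by auto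
  have "1 \<le> (\<Sum>t\<in>vec.span {R}. of_bool (F (v + t) \<noteq> 0) :: nat)" if "v \<notin> vec.span {R}" for v
  proof (rule ccontr)
    assume "\<not> ?thesis"
    then have "\<forall>t\<in>vec.span {R}. F (v + t) = 0"
      by (auto simp: Suc_le_eq card_gt_0_iff)
    then show False
      using line[OF R0 that] R by simp
  qed
  then show ?thesis
    using sum_ge_lines_through[OF U R(1) R0, of "\<lambda>v. of_bool (F v \<noteq> 0)" 1] R
    by (simp add: W_def zero scale)
qed

lemma W_plane_ge:
  assumes U: "vec.subspace U" "card U = q ^ Suc 2" and R: "R \<in> U" "F R \<noteq> 0"
  shows "(q - 1) * B \<le> p * W U"
proof (cases "\<exists>R'\<in>U. F R' = - F R")
  case True
  then obtain R' where R': "R' \<in> U" "F R' = - F R"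
    by blast
  obtain L :: "'f \<Rightarrow> nat" where L: "\<And>x. of_nat (L x) = x" "L 0 = 0" "L 1 = 1"
    and opp: "\<And>x. x \<noteq> 0 \<Longrightarrow> L x + L (- x) = p"
    and min: "\<And>m. of_nat m = (-1 :: 'f) \<Longrightarrow> p \<le> m + 1"
    using prime_field_lift[where 'f = 'f, unfolded card_f, OF prime_p] by metis
  \<comment> \<open>The lift is 1 at \<open>P\<close>, which accounts for the term
    \<open>q - 1\<close>. On a line the other values sum to \<open>- F P\<close>, so after division
    by \<open>F P\<close> their lifts sum to a natural number congruent to -1 modulo
    \<open>p\<close>.\<close>
  have half: "(q - 1) + (p - 1) * (q ^ 2 - 1) \<le> (\<Sum>v\<in>U. L (F v / F P))"
    if P: "P \<in> U" "F P \<noteq> 0" for P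
  proof -
    have P0: "P \<noteq> 0"
      using P zero by auto
    have "p - 1 \<le> (\<Sum>t\<in>vec.span {P}. L (F (v + t) / F P))" if v: "v \<notin> vec.span {P}" for v
    proof -
      have "of_nat (\<Sum>t\<in>vec.span {P}. L (F (v + t) / F P)) = (\<Sum>t\<in>vec.span {P}. F (v + t)) / F P"
        by (simp add: L sum_divide_distrib)
      also have "(\<Sum>t\<in>vec.span {P}. F (v + t)) = - F P"
        using line[OF P0 v] by (simp add: eq_neg_iff_add_eq_0 add.commute)
      finally have "of_nat (\<Sum>t\<in>vec.span {P}. L (F (v + t) / F P)) = (-1 :: 'f)"
        using P by simp
      from min[OF this] show ?thesis
        by simp
    qed
    then show ?thesis
      using sum_ge_lines_through[OF U P(1) P0, of "\<lambda>v. L (F v / F P)" "p - 1"] P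
      by (simp add: zero scale L)
  qed
  have "L (F v / F R) + L (F v / F R') = p * of_bool (F v \<noteq> 0)" for v
    using opp[of "F v / F R"] R by (auto simp: R' L)
  then have "(\<Sum>v\<in>U. L (F v / F R)) + (\<Sum>v\<in>U. L (F v / F R')) = p * W U"
    by (simp add: W_def sum_distrib_left flip: sum.distrib)
  then have "2 * ((q - 1) + (p - 1) * (q ^ 2 - 1)) \<le> p * W U"
    using half[of R] half[of R'] R R' by simp
  moreover have "(q - 1) * B = 2 * ((q - 1) + (p - 1) * (q ^ 2 - 1))"
    using p_gt_1 card_le by (cases p; cases q) (auto simp: algebra_simps power2_eq_square)
  ultimately show ?thesis
    by simp
next
  case False
  have R0: "R \<noteq> 0"
    using R zero by auto
  let ?T = "vec.span {R}"
  \<comment> \<open>If a line had only one further support point, the value there would be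
    \<open>- F R\<close>, which this case excludes.\<close>
  have "2 \<le> (\<Sum>t\<in>?T. of_bool (F (v + t) \<noteq> 0) :: nat)" if v: "v \<in> U" "v \<notin> ?T" for v
  proof (rule ccontr)
    let ?A = "{t \<in> ?T. F (v + t) \<noteq> 0}"
    assume "\<not> ?thesis"
    then have "card ?A \<le> 1"
      by (simp add: sum_of_bool_eq Int_def)
    have "(\<Sum>t\<in>?T. F (v + t)) = - F R"
      using line[OF R0 v(2)] by (simp add: eq_neg_iff_add_eq_0 add.commute)
    then have *: "(\<Sum>t\<in>?A. F (v + t)) = - F R"
      by (subst sum.mono_neutral_left[of ?T]) auto
    then have "?A \<noteq> {}"
      using R by (metis sum.empty neg_equal_0_iff_equal)
    then have "0 < card ?A"
      unfolding card_gt_0_iff by simp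
    then have "card ?A = 1"
      using \<open>card ?A \<le> 1\<close> by linarith
    then obtain t where t: "?A = {t}"
      by (rule card_1_singletonE)
    then have "F (v + t) = - F R"
      using * by simp
    moreover have "v + t \<in> U"
      using t v U R vec.span_minimal[of "{R}" U] by (intro vec.subspace_add) auto
    ultimately show False
      using False by blast
  qed
  then have "(q - 1) + 2 * (q ^ 2 - 1) \<le> W U"
    using sum_ge_lines_through[OF U R(1) R0, of "\<lambda>v. of_bool (F v \<noteq> 0)" 2] R
    by (simp add: W_def zero scale)
  then have "p * ((q - 1) + 2 * (q ^ 2 - 1)) \<le> p * W U"
    by simp
  moreover have "(q - 1) * B \<le> p * ((q - 1) + 2 * (q ^ 2 - 1))"
    using p_gt_1 card_le by (cases p; cases q) (auto simp: algebra_simps power2_eq_square)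
  ultimately show ?thesis
    by linarith
qed

section \<open>Induction on the dimension\<close>

text \<open>If all extensions of \<open>T\<close> by a vector of \<open>U\<close> met the support,
  \<open>bound\<close> would apply to each of them, and averaging over the cosets of
  \<open>T\<close> would contradict \<open>small\<close>. Here \<open>small\<close> negates the
  desired bound for \<open>U\<close>, and \<open>bound\<close> is the induction hypothesis for the
  lower dimension \<open>j + 1\<close>.\<close>

lemma extend_missed_subspace:
  assumes U: "vec.subspace U" "card U = q ^ Suc k"
    and T: "vec.subspace T" "card T = q ^ j" "T \<subseteq> U" "\<And>t. t \<in> T \<Longrightarrow> F t = 0"
    and "j < k" and small: "p * q\<^sup>2 * W U < (q - 1) * B * q ^ k"
    and bound: "\<And>V R. vec.subspace V \<Longrightarrow> card V = q ^ Suc j \<Longrightarrow> R \<in> V \<Longrightarrow> F R \<noteq> 0 \<Longrightarrow>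
      (q - 1) * B * q ^ j \<le> p * q\<^sup>2 * W V"
  obtains v where "v \<in> U" "v \<notin> T" "\<And>x. x \<in> vec.span (insert v T) \<Longrightarrow> F x = 0"
proof (rule ccontr)
  assume contra: "\<not> thesis"
  note extend = that
  have q: "1 < q"
    using p_gt_1 card_le by simp
  \<comment> \<open>Since \<open>F\<close> vanishes on \<open>T\<close>, the support in the span
    consists of the nonzero multiples of the support in the coset \<open>v + T\<close>, so a factor
    \<open>q - 1\<close> cancels.\<close>
  have hit: "B * q ^ j \<le> p * q\<^sup>2 * (\<Sum>t\<in>T. of_bool (F (v + t) \<noteq> 0))" if v: "v \<in> U - T" for v
  proof -
    let ?V = "vec.span (insert v T)"
    have "\<exists>x\<in>?V. F x \<noteq> 0"
      using contra extend[of v] v by blast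
    then obtain x where x: "x \<in> ?V" "F x \<noteq> 0"
      by blast
    have "W ?V = (q - 1) * (\<Sum>t\<in>T. of_bool (F (v + t) \<noteq> 0))"
      using sum_span_insert[OF T(1), of v "\<lambda>v. of_bool (F v \<noteq> 0) :: nat"] v T(4)
      by (simp add: W_def scale)
    moreover have "(q - 1) * B * q ^ j \<le> p * q\<^sup>2 * W ?V"
      using v x T by (intro bound) (auto simp: card_span_insert)
    ultimately have "(q - 1) * (B * q ^ j) \<le> (q - 1) * (p * q\<^sup>2 * (\<Sum>t\<in>T. of_bool (F (v + t) \<noteq> 0)))"
      by (simp only: mult_ac)
    then show ?thesis
      using q by simp
  qed
  have "card (U - T) * (B * q ^ j) \<le> p * q\<^sup>2 * (\<Sum>v\<in>U - T. \<Sum>t\<in>T. of_bool (F (v + t) \<noteq> 0))"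
    using sum_mono[OF hit, of "U - T" "\<lambda>v. v"] by (simp add: sum_distrib_left)
  also have "\<dots> = p * q\<^sup>2 * (q ^ j * W (U - T))"
    using sum_translates[OF T(1) U(1) T(3), of "\<lambda>v. of_bool (F v \<noteq> 0) :: nat"] T(2)
    by (simp add: W_def)
  also have "\<dots> \<le> p * q\<^sup>2 * (q ^ j * W U)"
    unfolding W_def by (intro mult_left_mono sum_mono2) auto
  finally have "q ^ j * (card (U - T) * B) \<le> q ^ j * (p * q\<^sup>2 * W U)"
    by (simp only: mult_ac)
  then have "card (U - T) * B \<le> p * q\<^sup>2 * W U"
    using q by simp
  moreover have "(q - 1) * q ^ k \<le> card (U - T)"
  proof -
    have "q ^ j \<le> q ^ k"
      using q \<open>j < k\<close> by (intro power_increasing) auto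
    then show ?thesis
      using U T by (simp add: card_Diff_subset diff_mult_distrib)
  qed
  then have "(q - 1) * q ^ k * B \<le> card (U - T) * B"
    by (rule mult_right_mono) simp
  ultimately show False
    using small by (simp only: mult_ac)
qed

text \<open>The number \<open>k\<close> is the projective dimension. The denominators
  \<open>p\<close> and \<open>q\<^sup>2\<close> are cleared, so that \<open>k < 2\<close> fits the
  same formula; the induction needs these small cases because the missed subspaces are grown from
  \<open>{0}\<close>.\<close>

lemma W_bound:
  assumes "vec.subspace U" "card U = q ^ Suc k" "R \<in> U" "F R \<noteq> 0"
  shows "(q - 1) * B * q ^ k \<le> p * q\<^sup>2 * W U"
  using assms
proof (induction k arbitrary: U R rule: less_induct)
  case (less k)
  note U = less.prems(1,2) and R = less.prems(3,4)
  have q: "2 \<le> q"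
    using p_gt_1 card_le by simp
  have B: "B \<le> 2 * (p * q)"
    using p_gt_1 card_le by (cases p) auto
  \<comment> \<open>Points and lines follow from \<open>W_ge\<close> and planes from
    \<open>W_plane_ge\<close>. From \<open>k = 3\<close> on, the count along lines is large enough
    to contradict the second moment bound.\<close>
  consider "k = 0" | "k = 1" | "k = 2" | "3 \<le> k"
    by linarith
  then show ?case
  proof cases
    case 1
    have "2 * (p * q) \<le> p * q\<^sup>2"
      using mult_right_mono[OF q, of "p * q"] by (simp add: power2_eq_square mult_ac)
    then have "B \<le> p * q\<^sup>2"
      using B by linarith
    moreover have "q - 1 \<le> W U"
      using W_ge[OF U R] 1 by simp
    ultimately have "B * (q - 1) \<le> p * q\<^sup>2 * W U"
      by (rule mult_mono) auto
    then show ?thesis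
      using 1 by (simp add: mult_ac)
  next
    case 2
    have "2 * (q - 1) \<le> W U"
      using W_ge[OF U R] 2 by simp
    then have "p * q\<^sup>2 * (2 * (q - 1)) \<le> p * q\<^sup>2 * W U"
      by (rule mult_left_mono) simp
    moreover have "B * (q * (q - 1)) \<le> 2 * (p * q) * (q * (q - 1))"
      using B by (rule mult_right_mono) simp
    moreover have "2 * (p * q) * (q * (q - 1)) = p * q\<^sup>2 * (2 * (q - 1))"
      by (simp only: power2_eq_square mult_ac)
    ultimately have "B * (q * (q - 1)) \<le> p * q\<^sup>2 * W U"
      by linarith
    then show ?thesis
      unfolding 2 power_one_right by (simp only: mult_ac)
  next
    case 3
    then have "(q - 1) * B \<le> p * W U"
      using W_plane_ge[OF _ _ R] U by simp
    then have "(q - 1) * B * q\<^sup>2 \<le> p * W U * q\<^sup>2"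
      by (rule mult_right_mono) simp
    then show ?thesis
      using 3 by (simp add: mult_ac)
  next
    case 4
    show ?thesis
    proof (rule ccontr)
      assume "\<not> ?thesis"
      then have small: "p * q\<^sup>2 * W U < (q - 1) * B * q ^ k"
        by simp
      have "\<exists>T. vec.subspace T \<and> card T = q ^ j \<and> T \<subseteq> U \<and> (\<forall>t\<in>T. F t = 0)" if "j \<le> k" for j
        using that
      proof (induction j)
        case 0
        have "vec.subspace ({0} :: ('k ^ 'n) set)"
          by (simp add: vec.subspace_def)
        then show ?case
          using zero vec.subspace_0[OF U(1)] by (intro exI[of _ "{0}"]) auto
      next
        case (Suc j)
        then obtain T where T: "vec.subspace T" "card T = q ^ j" "T \<subseteq> U" "\<And>t. t \<in> T \<Longrightarrow> F t = 0"
          by auto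
        have "j < k"
          using Suc by simp
        obtain v where v: "v \<in> U" "v \<notin> T" "\<And>x. x \<in> vec.span (insert v T) \<Longrightarrow> F x = 0"
          by (rule extend_missed_subspace[OF U T(1-3) _ \<open>j < k\<close> small])
            (use T(4) less.IH[OF \<open>j < k\<close>] in blast)+
        have "vec.span (insert v T) \<subseteq> U"
          using v T U by (intro vec.span_minimal) auto
        then show ?case
          using v T by (intro exI[of _ "vec.span (insert v T)"]) (auto simp: card_span_insert)
      qed
      then obtain H where H: "vec.subspace H" "card H = q ^ k" "H \<subseteq> U" "\<And>t. t \<in> H \<Longrightarrow> F t = 0"
        by blast
      have "H \<noteq> U"
        using H U q by auto
      then obtain u where u: "u \<in> U" "u \<notin> H"
        using H by blast
      \<comment> \<open>Normalising the coefficient of \<open>u\<close> to 1 identifies the points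
        of \<open>U\<close> off \<open>H\<close> with the vectors of \<open>H\<close>. In these
        affine coordinates \<open>S\<close> is the support, and parallel hyperplanes are the fibres
        of a linear form on \<open>H\<close>.\<close>
      define S where "S = {x \<in> H. F (u + x) \<noteq> 0}"
      have "vec.span (insert u H) = U"
        using u H U by (intro card_subset_eq vec.span_minimal) (auto simp: card_span_insert)
      then have W_U: "W U = (q - 1) * card S"
        using sum_span_insert[OF H(1) u(2), of "\<lambda>v. of_bool (F v \<noteq> 0) :: nat"] H(4)
        by (simp add: W_def scale S_def sum_of_bool_eq Int_def)
      have "\<exists>c. \<forall>x\<in>S. (\<Sum>i\<in>UNIV. y $ i * x $ i) \<noteq> c" for y :: "'k ^ 'n"
      proof (rule ccontr)
        define f where "f x = (\<Sum>i\<in>UNIV. y $ i * x $ i)" for x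
        have f: "f (x + x') = f x + f x'" "f (a *s x) = a * f x" for x x' a
          by (auto simp: f_def sum.distrib distrib_left sum_distrib_left mult_ac)
        assume "\<not> ?thesis"
        then have "\<forall>c. \<exists>x\<in>S. f x = c"
          by (auto simp: f_def)
        then obtain X where X: "\<And>c. X c \<in> S" "\<And>c. f (X c) = c"
          by metis
        have "X 1 \<in> H" "f (X 1) \<noteq> 0"
          using X by (auto simp: S_def)
        let ?K = "{x \<in> H. f x = 0}"
        note K = card_kernel[of H "X 1" f, OF H(1) \<open>X 1 \<in> H\<close> \<open>f (X 1) \<noteq> 0\<close> f]
        obtain k' where k': "k = Suc k'"
          using 4 by (cases k) auto
        have card_K: "card ?K = q ^ k'"
          using K(2) H(2) k' q by simp
        \<comment> \<open>The fibre over \<open>c\<close>, shifted by \<open>u\<close>, is up to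
          scaling the part of \<open>?V\<close> off \<open>?K\<close>. As \<open>?V\<close> is a
          hyperplane of \<open>U\<close> containing the support point \<open>u + X c\<close>, the
          induction hypothesis applies to it.\<close>
        have "B * q ^ k' \<le> p * q\<^sup>2 * card {x \<in> S. f x = c}" for c
        proof -
          let ?v = "u + X c"
          let ?V = "vec.span (insert ?v ?K)"
          have Xc: "X c \<in> H" "F ?v \<noteq> 0"
            using X by (auto simp: S_def)
          have nin: "?v \<notin> ?K"
            using u vec.subspace_diff[OF H(1), of ?v "X c"] Xc by auto
          have "bij_betw (\<lambda>t. X c + t) {t \<in> ?K. F (?v + t) \<noteq> 0} {x \<in> S. f x = c}"
          proof (rule bij_betwI[where g = "\<lambda>x. x - X c"])
            show "(\<lambda>t. X c + t) \<in> {t \<in> ?K. F (?v + t) \<noteq> 0} \<rightarrow> {x \<in> S. f x = c}"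
              using Xc X(2) by (auto simp: S_def f add.assoc intro!: vec.subspace_add[OF H(1)])
            have "f (x - X c) = f x - c" for x
              using f(1)[of "x - X c" "X c"] X(2) by (simp add: eq_diff_eq)
            then show "(\<lambda>x. x - X c) \<in> {x \<in> S. f x = c} \<rightarrow> {t \<in> ?K. F (?v + t) \<noteq> 0}"
              using Xc X(2) by (auto simp: S_def intro!: vec.subspace_diff[OF H(1)])
          qed auto
          then have card: "card {t \<in> ?K. F (?v + t) \<noteq> 0} = card {x \<in> S. f x = c}"
            by (rule bij_betw_same_card)
          have "sum (\<lambda>v. of_bool (F v \<noteq> 0)) ?K = (0 :: nat)"
            using H(4) by simp
          then have "W ?V = (q - 1) * card {x \<in> S. f x = c}"
            using sum_span_insert[OF K(1) nin, of "\<lambda>v. of_bool (F v \<noteq> 0) :: nat"] card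
            by (simp add: W_def scale sum_of_bool_eq Int_def)
          moreover have "(q - 1) * B * q ^ k' \<le> p * q\<^sup>2 * W ?V"
            using k' Xc K(1) nin card_K
            by (intro less.IH[of k' ?V ?v]) (auto simp: card_span_insert intro: vec.span_base)
          ultimately have "(q - 1) * (B * q ^ k') \<le> (q - 1) * (p * q\<^sup>2 * card {x \<in> S. f x = c})"
            by (simp only: mult_ac)
          then show ?thesis
            using q by simp
        qed
        \<comment> \<open>Summing over the \<open>q\<close> fibres regains the factor
          \<open>q\<close> lost by the drop in dimension.\<close>
        then have "(\<Sum>c\<in>(UNIV :: 'k set). B * q ^ k') \<le> (\<Sum>c\<in>UNIV. p * q\<^sup>2 * card {x \<in> S. f x = c})"
          by (rule sum_mono)
        also have "\<dots> = p * q\<^sup>2 * (\<Sum>c\<in>UNIV. card {x \<in> S. f x = c})"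
          by (simp only: sum_distrib_left)
        also have "(\<Sum>c\<in>UNIV. card {x \<in> S. f x = c}) = card S"
          using sum.group[of S UNIV f "\<lambda>_. 1 :: nat"] by simp
        finally have "B * q ^ k \<le> p * q\<^sup>2 * card S"
          using k' by (simp add: mult_ac)
        then have "(q - 1) * (B * q ^ k) \<le> (q - 1) * (p * q\<^sup>2 * card S)"
          by (rule mult_left_mono) simp
        then show False
          using small W_U by (simp only: mult_ac)
      qed
      then have "card S \<le> (q - 1)\<^sup>2"
        by (rule card_le_if_functionals_not_onto[where 'k = 'k, unfolded card_k])
      then have "W U \<le> (q - 1) * (q - 1)\<^sup>2"
        unfolding W_U by (rule mult_left_mono) simp
      \<comment> \<open>Already in dimension 3 the lines through \<open>R\<close> force more than
        \<open>(q - 1) ^ 3\<close> vectors into the support.\<close>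
      moreover have "(q - 1) + (q ^ 3 - 1) \<le> W U"
        using W_ge[OF U R] 4 q power_increasing[of 3 k q] by linarith
      ultimately have "(q - 1) + (q ^ 3 - 1) \<le> (q - 1) * (q - 1)\<^sup>2"
        by linarith
      then show False
        using q by (cases q) (auto simp: power2_eq_square power3_eq_cube algebra_simps)
    qed
  qed
qed

end

section \<open>Projective points and their nonzero vectors\<close>

lemma subspace_point_of_span:
  fixes v :: "('k :: {field,finite}) ^ ('n :: finite)"
  assumes "v \<noteq> 0"
  shows "subspace_of_point (point_of_subspace (vec.span {v})) = vec.span {v}"
  using assms by (intro point_of_subspace_inverse) simp

text \<open>A one-dimensional subspace is spanned by any of its nonzero vectors.\<close>

lemma point_of_span_eq_iff:
  fixes v :: "('k :: {field,finite}) ^ ('n :: finite)"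
  assumes v: "v \<noteq> 0"
  shows "point_of_subspace (vec.span {v}) = P \<longleftrightarrow> v \<in> subspace_of_point P"
proof
  assume "point_of_subspace (vec.span {v}) = P"
  then show "v \<in> subspace_of_point P"
    using subspace_point_of_span[OF v] by (auto intro: vec.span_base)
next
  assume "v \<in> subspace_of_point P"
  moreover have P: "vec.subspace (subspace_of_point P)" "vec.dim (subspace_of_point P) = 1"
    using subspace_of_point[of P] by auto
  ultimately have "vec.span {v} = subspace_of_point P"
    using v by (intro vec.subspace_dim_equal vec.span_minimal) auto
  then show "point_of_subspace (vec.span {v}) = P"
    by (simp add: subspace_of_point_inverse)
qed

lemma ex_nonzero_in_point:
  fixes P :: "('k :: {field,finite}, 'n :: finite) pg_point"
  obtains v where "v \<in> subspace_of_point P" "v \<noteq> 0"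
proof -
  have "vec.dim (subspace_of_point P) = 1"
    using subspace_of_point[of P] by auto
  then have "\<not> subspace_of_point P \<subseteq> {0}"
    using vec.dim_eq_0[of "subspace_of_point P"] by linarith
  then show thesis
    using that by blast
qed

lemma card_point:
  fixes P :: "('k :: {field,finite}, 'n :: finite) pg_point"
  shows "card (subspace_of_point P) = CARD('k)"
proof -
  obtain v where v: "v \<in> subspace_of_point P" "v \<noteq> 0"
    by (rule ex_nonzero_in_point)
  then have "subspace_of_point P = vec.span (insert v {0})"
    using point_of_span_eq_iff[of v P] subspace_point_of_span[of v] by (simp add: insert_commute)
  moreover have "vec.subspace ({0} :: ('k ^ 'n) set)"
    by (simp add: vec.subspace_def)
  ultimately show ?thesis
    using card_span_insert[of "{0}" v] v by simp
qed

text \<open>The fibres of the map from nonzero vectors to points all have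
  \<open>CARD('k) - 1\<close> elements. The identity serves both for line sums in \<open>'f\<close>
  and for counting the weight.\<close>

lemma sum_over_points:
  fixes g :: "('k :: {field,finite}, 'n :: finite) pg_point \<Rightarrow> 'b :: comm_semiring_1"
  assumes V: "vec.subspace V"
  shows "(\<Sum>v\<in>V - {0}. g (point_of_subspace (vec.span {v}))) =
    of_nat (CARD('k) - 1) * sum g {P. subspace_of_point P \<subseteq> V}"
proof -
  let ?pt = "\<lambda>v. point_of_subspace (vec.span {v}) :: ('k, 'n) pg_point"
  let ?A = "{P. subspace_of_point P \<subseteq> V}"
  have "?pt ` (V - {0}) \<subseteq> ?A"
    using V by (auto simp: subspace_point_of_span intro: vec.span_minimal[THEN subsetD])
  then have "(\<Sum>v\<in>V - {0}. g (?pt v)) = (\<Sum>P\<in>?A. \<Sum>v\<in>{v \<in> V - {0}. ?pt v = P}. g (?pt v))"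
    by (intro sum.group[symmetric]) auto
  also have "\<dots> = (\<Sum>P\<in>?A. of_nat (CARD('k) - 1) * g P)"
  proof (intro sum.cong refl)
    fix P assume "P \<in> ?A"
    then have "{v \<in> V - {0}. ?pt v = P} = subspace_of_point P - {0}"
      by (auto simp: point_of_span_eq_iff subspace_point_of_span intro: vec.span_base)
    moreover have "0 \<in> subspace_of_point P"
      using subspace_of_point[of P] by (auto intro: vec.subspace_0)
    ultimately have "card {v \<in> V - {0}. ?pt v = P} = CARD('k) - 1"
      by (simp add: card_point card_Diff_singleton)
    then show "(\<Sum>v\<in>{v \<in> V - {0}. ?pt v = P}. g (?pt v)) = of_nat (CARD('k) - 1) * g P"
      by simp
  qed
  finally show ?thesis
    by (simp add: sum_distrib_left)
qed

lemma sum_line_eq_0: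
  fixes s :: "'f :: field ^ ('k :: {field,finite}, 'n :: finite) pg_point"
  assumes s: "s \<in> dual_code code_PG" and V: "vec.subspace V" "vec.dim V = 2"
  shows "(\<Sum>P\<in>{P. subspace_of_point P \<subseteq> V}. s $ P) = 0"
proof -
  let ?l = "{P. subspace_of_point P \<subseteq> V}"
  have "?l \<in> pg_lines"
    using V unfolding pg_lines_def by blast
  then have "incidence_vector ?l \<in> (code_PG :: ('f ^ ('k, 'n) pg_point) set)"
    unfolding code_PG_def by (intro vec.span_base imageI)
  then have "(\<Sum>P\<in>UNIV. s $ P * incidence_vector ?l $ P) = 0"
    using s unfolding dual_code_def by blast
  moreover have "(\<Sum>P\<in>UNIV. s $ P * incidence_vector ?l $ P) = (\<Sum>P\<in>UNIV. if P \<in> ?l then s $ P else 0)"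
    by (intro sum.cong) (auto simp: incidence_vector_def)
  ultimately show ?thesis
    by (simp add: sum.If_cases Int_def)
qed

section \<open>From a dual codeword to a function on vectors\<close>

theorem theorem4p4:
  fixes p h q m :: nat
    and s :: "'f :: field ^ ('k :: {field,finite}, 'n :: finite) pg_point"
  assumes "prime p" and "q = p ^ h" and "q > p" and "m \<ge> 1"
    and "CARD('f) = p" and "CARD('k) = q" and "CARD('n) = m + 1"
    and "s \<in> dual_code code_PG" and "s \<noteq> 0"
  shows "real (weight s) \<ge>
    2 * (real q powi (int m - 1) * ((real p - 1) / real p) + real q powi (int m - 2))"
proof -
  \<comment> \<open>The value 0 at the zero vector is a default that keeps it out of the support;
    elsewhere \<open>s\<close> is pulled back along the map from vectors to points.\<close>
  define F :: "'k ^ 'n \<Rightarrow> 'f"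
    where "F v = (if v = 0 then 0 else s $ point_of_subspace (vec.span {v}))" for v
  have p: "1 < p"
    using assms(1) prime_gt_1_nat by blast
  have "h \<noteq> 0"
    using assms(2,3) p by (cases h) auto
  moreover have "finite (UNIV :: 'f set)"
    using assms(5) p by (intro card_ge_0_finite) auto
  then have "CHAR('f) dvd p"
    using CHAR_dvd_CARD assms(5) by blast
  ultimately have "CHAR('f) dvd q"
    using assms(2) by (meson dvd_power dvd_trans neq0_conv)
  then have "of_nat q = (0 :: 'f)"
    by (simp add: of_nat_eq_0_iff_char_dvd)
  \<comment> \<open>As \<open>q\<close> vanishes in \<open>'f\<close>, the factor
    \<open>q - 1\<close> relating sums over vectors to sums over points is just a sign.\<close>
  then have q1: "of_nat (q - 1) = (-1 :: 'f)"
    using assms(3) by (simp add: of_nat_diff)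
  have scale: "F (a *s v) = F v" if "a \<noteq> 0" for a v
  proof (cases "v = 0")
    case False
    then have v: "v \<in> subspace_of_point (point_of_subspace (vec.span {v}))"
      by (simp add: subspace_point_of_span vec.span_base)
    have "vec.subspace (subspace_of_point (point_of_subspace (vec.span {v}) :: ('k, 'n) pg_point))"
      using subspace_of_point by blast
    then have "a *s v \<in> subspace_of_point (point_of_subspace (vec.span {v}))"
      using v by (rule vec.subspace_scale)
    then have "point_of_subspace (vec.span {a *s v}) = (point_of_subspace (vec.span {v}) :: ('k, 'n) pg_point)"
      using that False by (subst point_of_span_eq_iff) auto
    then show ?thesis
      using that False by (simp add: F_def)
  qed (simp add: F_def)
  have sum_F: "sum F V = (\<Sum>v\<in>V - {0}. s $ point_of_subspace (vec.span {v}))" if "0 \<in> V" for V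
    using that by (subst sum.remove[of V 0]) (auto simp: F_def intro!: sum.cong)
  interpret line_null F p q
  proof
    show "CARD('f) = p" "CARD('k) = q" "prime p" "p \<le> q" "F 0 = 0"
      using assms by (auto simp: F_def)
    show "F (a *s v) = F v" if "a \<noteq> 0" for a v
      using that by (rule scale)
  next
    fix R v :: "'k ^ 'n" assume R: "R \<noteq> 0" and v: "v \<notin> vec.span {R}"
    \<comment> \<open>\<open>F\<close> is summed over \<open>?V\<close> in two ways: by points this
      is a multiple of the vanishing line sum, and by cosets of the span of \<open>R\<close> it is
      \<open>- F R\<close> minus the sum over \<open>v + t\<close>.\<close>
    let ?V = "vec.span (insert v (vec.span {R}))"
    have "vec.dim ?V = 2"
      using R v by (simp add: vec.dim_insert vec.span_span)
    then have "sum F ?V = 0"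
      using sum_over_points[of ?V "\<lambda>P. s $ P"] sum_line_eq_0[OF assms(8), of ?V]
      by (simp add: sum_F vec.span_zero)
    moreover have "sum F (vec.span {R}) = - F R"
      using sum_span_insert[of "{0}" R F] R scale q1 assms(6)
      by (simp add: insert_commute vec.subspace_def F_def)
    moreover have "sum F ?V = sum F (vec.span {R}) - (\<Sum>t\<in>vec.span {R}. F (v + t))"
      using sum_span_insert[of "vec.span {R}" v F] v scale q1 assms(6) by simp
    ultimately have "- F R = (\<Sum>t\<in>vec.span {R}. F (v + t))"
      by simp
    then show "F R + (\<Sum>t\<in>vec.span {R}. F (v + t)) = 0"
      by (simp add: neg_eq_iff_add_eq_0)
  qed
  obtain P where P: "s $ P \<noteq> 0"
    using assms(9) by (auto simp: vec_eq_iff)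
  obtain R where R: "R \<in> subspace_of_point P" "R \<noteq> 0"
    by (rule ex_nonzero_in_point)
  then have "F R \<noteq> 0"
    using P point_of_span_eq_iff[of R P] by (simp add: F_def)
  then have bound: "(q - 1) * B * q ^ m \<le> p * q\<^sup>2 * W UNIV"
    using assms(7) by (intro W_bound[of UNIV m R]) auto
  have "W UNIV = (\<Sum>v\<in>UNIV - {0}. of_bool (s $ point_of_subspace (vec.span {v}) \<noteq> 0))"
    unfolding W_def by (subst sum.remove[of UNIV 0]) (auto simp: F_def intro!: sum.cong)
  also have "\<dots> = (q - 1) * weight s"
    using sum_over_points[of UNIV "\<lambda>P. of_bool (s $ P \<noteq> 0) :: nat"]
    by (simp add: weight_def sum_of_bool_eq Int_def)
  finally have W: "W UNIV = (q - 1) * weight s" .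
  have "(q - 1) * (B * q ^ m) \<le> (q - 1) * (p * q\<^sup>2 * weight s)"
    using bound unfolding W by (simp only: mult_ac)
  then have "B * q ^ m \<le> p * q\<^sup>2 * weight s"
    using assms(3) p by simp
  then have "real (B * q ^ m) \<le> real (p * q\<^sup>2 * weight s)"
    by (simp only: of_nat_le_iff)
  then have "2 * ((real p - 1) * q + p) * real q ^ m \<le> real p * (real q)\<^sup>2 * weight s"
    using p by (simp add: of_nat_diff)
  \<comment> \<open>It remains to divide by \<open>p * q\<^sup>2\<close>; integer powers occur
    because \<open>m - 2\<close> is negative for \<open>m = 1\<close>.\<close>
  moreover have "2 * (real q powi (int m - 1) * ((real p - 1) / real p) + real q powi (int m - 2)) =
      2 * ((real p - 1) * q + p) * real q ^ m / (real p * (real q)\<^sup>2)"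
    using p assms(3) by (simp add: power_int_diff field_simps power2_eq_square)
  ultimately show ?thesis
    using p assms(3) by (simp add: divide_le_eq mult.commute)
qed

end
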